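(* For every integer $n>0$, the gap $g=2n$ occurs infinitely often in Eratosthenes sieve (that is, $2n$ occurs as a gap in the cycle of gaps $\mathcal{G}(p^\#)$ for infinitely many primes $p$), and the ratio of the number of occurrences of the gap $2n$ to the number of occurrences of the gap $2$ converges: $$ \lim_{p\to\infty} \frac{N_{2n}(p^\#)}{N_2(p^\#)} = \prod_{q>2,\ q\mid n}\frac{q-1}{q-2},$$ where the limit is over primes $p$ and the product is over primes $q$.
   Context: For a prime $p$, $p^\#$ denotes the primorial of $p$, the product of all primes from $2$ up to and including $p$. For an integer $N\ge 2$, the cycle of gaps $\mathcal{G}(N)=g_1 g_2\cdots g_{\phi(N)}$ is the cyclic sequence of differences between consecutive positive integers coprime to $N$, where $g_1$ is the difference between $1$ and the next larger integer coprime to $N$; it has $\phi(N)$ entries, which sum to $N$. For a positive integer $g$, $N_g(p^\#)$ is the number of indices $i\in\{1,\dots,\phi(p^\#)\}$ with $g_i=g$ in $\mathcal{G}(p^\#)$. *)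

theory Defs
  imports Complex_Main "HOL-Library.Infinite_Set" "HOL-Number_Theory.Totient"
begin

definition primorial :: "nat \<Rightarrow> nat" where
  "primorial p = (\<Prod>q\<in>{q. prime q \<and> q \<le> p}. q)"

definition coprimes :: "nat \<Rightarrow> nat set" where
  "coprimes N = {k. 0 < k \<and> coprime k N}"

text \<open>
  The function \<^term>\<open>enumerate\<close> lists the coprime integers in increasing order starting at
  index 0, whose value is 1; hence \<^term>\<open>gap N 1\<close> is the difference between 1 and the next
  larger integer coprime to \<^term>\<open>N\<close>. Only indices \<^term>\<open>i \<ge> 1\<close> are meaningful.
\<close>
definition gap :: "nat \<Rightarrow> nat \<Rightarrow> nat" where
  "gap N i = enumerate (coprimes N) i - enumerate (coprimes N) (i - 1)"

definition cycle_of_gaps :: "nat \<Rightarrow> nat list" where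
  "cycle_of_gaps N = map (gap N) [1..<Suc (totient N)]"

definition gap_count :: "nat \<Rightarrow> nat \<Rightarrow> nat" where
  "gap_count g N = card {i \<in> {1..totient N}. gap N i = g}"

end

(*
  By the Chinese remainder theorem, the number of k modulo N = p# such that k + h is coprime to N
  for all h in H is the product over the primes q <= p of q - nu_q(H), where nu_q(H) is the number
  of residue classes of H modulo q. For H = {0, 2n} and H = {0, 2} the quotient of these products
  equals the claimed limit as soon as p >= n. A pair k, k + 2n counted for H = {0, 2n} fails to be
  a gap only if some k + j with 0 < j < 2n is coprime to N as well. Relative to the count for
  {0, 2}, the number of such triples is at most a constant times the product of 1 - 1/q over
  q <= p, because (q - 3)/(q - 2) <= 1 - 1/q, and this tends to 0 by Euler's comparison with the
  harmonic series.
*)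
theory Submission
  imports Defs "HOL-Analysis.Harmonic_Numbers"
begin

text \<open>Residues modulo \<open>N\<close> are represented by \<open>{..<N}\<close>, so
  \<open>tuple_count 1 H = 1\<close>, which is the base case for products over sets of
  primes.\<close>

definition tuple_count :: "nat \<Rightarrow> nat set \<Rightarrow> nat" where
  "tuple_count N H = card {k \<in> {..<N}. \<forall>h\<in>H. coprime (k + h) N}"

section \<open>Gaps located by their left endpoints\<close>

lemma coprimes_infinite:
  assumes "N > 0"
  shows "infinite (coprimes N)"
proof -
  have "inj (\<lambda>k. k * N + 1)"
    using assms by (auto intro: injI)
  then have "infinite (range (\<lambda>k. k * N + 1))"
    by (simp add: finite_image_iff)
  moreover have "coprime (k * N + 1) N" for k
    using gcd_add_mult[of N k 1] by (simp add: coprime_iff_gcd_eq_1 gcd.commute)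
  then have "range (\<lambda>k. k * N + 1) \<subseteq> coprimes N"
    by (auto simp: coprimes_def)
  ultimately show ?thesis
    using finite_subset by blast
qed

text \<open>Since \<open>enumerate\<close> is strictly increasing, the indices with value at most
  \<open>N\<close> form an initial segment \<open>{..<m}\<close>. Its image is the set of totatives,
  and injectivity then forces \<open>m = totient N\<close>.\<close>

lemma enumerate_coprimes_image:
  assumes "N > 0"
  shows "enumerate (coprimes N) ` {..<totient N} = totatives N"
proof -
  let ?E = "enumerate (coprimes N)"
  note inf = coprimes_infinite[OF assms]
  have "N < ?E (Suc N)"
    using le_enumerate[OF inf, of "Suc N"] by linarith
  define m where "m = (LEAST i. N < ?E i)"
  have m: "N < ?E m"
    unfolding m_def by (rule LeastI) fact
  have below: "?E i \<le> N \<longleftrightarrow> i < m" for i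
  proof
    assume "?E i \<le> N"
    with m have "?E i < ?E m" by linarith
    then show "i < m" using inf by simp
  next
    assume "i < m"
    then show "?E i \<le> N" unfolding m_def using not_less_Least not_less by blast
  qed
  have tot: "totatives N = {x \<in> coprimes N. x \<le> N}"
    by (auto simp: in_totatives_iff coprimes_def)
  have image: "?E ` {..<m} = totatives N"
  proof safe
    fix i assume "i < m"
    then show "?E i \<in> totatives N"
      using below enumerate_in_set[OF inf] by (auto simp: tot)
  next
    fix x assume "x \<in> totatives N"
    then have x: "x \<in> coprimes N" "x \<le> N" by (auto simp: tot)
    then obtain i where "?E i = x" using enumerate_Ex[OF inf] by blast
    then show "x \<in> ?E ` {..<m}" using x below by auto
  qed
  moreover have "inj_on ?E {..<m}"
    using inj_enumerate[OF inf] by (auto intro: inj_on_subset)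
  ultimately have "m = totient N"
    unfolding totient_def by (metis card_image card_lessThan)
  with image show ?thesis by simp
qed

lemma enumerate_Suc_eq_add_iff:
  fixes S :: "nat set"
  assumes "infinite S" "g > 0"
  shows "enumerate S (Suc i) = enumerate S i + g \<longleftrightarrow>
    enumerate S i + g \<in> S \<and> (\<forall>j\<in>{0<..<g}. enumerate S i + j \<notin> S)"
    (is "?l \<longleftrightarrow> ?r")
proof
  assume ?l
  have "s \<notin> S" if "enumerate S i < s" "s < enumerate S (Suc i)" for s
    using not_less_Least[of s "\<lambda>s. s \<in> S \<and> enumerate S i < s"] that
    by (auto simp: enumerate_Suc''[OF assms(1)])
  with \<open>?l\<close> enumerate_in_set[OF assms(1), of "Suc i"] show ?r
    by auto
next
  assume r: ?r
  have "enumerate S i + g \<le> s" if "s \<in> S" "enumerate S i < s" for s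
  proof (rule ccontr)
    assume "\<not> enumerate S i + g \<le> s"
    then have "s - enumerate S i \<in> {0<..<g}" "enumerate S i + (s - enumerate S i) = s"
      using that by auto
    with r that show False by metis
  qed
  then show ?l
    unfolding enumerate_Suc''[OF assms(1)]
    using r assms(2) by (intro Least_equality) auto
qed

text \<open>Each gap is determined by its left endpoint, and the left endpoints of one cycle are
  exactly the totatives. Counting endpoints instead of indices turns the gap count into a count of
  residues modulo \<open>N\<close>.\<close>

lemma gap_count_eq_card:
  assumes "N > 1" "g > 0"
  shows "gap_count g N =
    card {k \<in> {..<N}. coprime k N \<and> coprime (k + g) N \<and> (\<forall>j\<in>{0<..<g}. \<not> coprime (k + j) N)}"
proof -
  let ?E = "enumerate (coprimes N)"
  let ?Q = "\<lambda>k. k + g \<in> coprimes N \<and> (\<forall>j\<in>{0<..<g}. k + j \<notin> coprimes N)"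
  have inf: "infinite (coprimes N)" using coprimes_infinite assms by simp
  have gap: "gap N (Suc i) = g \<longleftrightarrow> ?Q (?E i)" for i
  proof -
    \<comment> \<open>The natural-number difference in \<open>gap\<close> loses nothing here,
      because consecutive values of \<open>enumerate\<close> increase.\<close>
    have "gap N (Suc i) = g \<longleftrightarrow> ?E (Suc i) = ?E i + g"
      using enumerate_step[OF inf, of i] by (auto simp: gap_def)
    then show ?thesis
      using enumerate_Suc_eq_add_iff[OF inf assms(2)] by simp
  qed
  have "{i \<in> {1..totient N}. gap N i = g} = Suc ` {i. i < totient N \<and> gap N (Suc i) = g}"
  proof (intro equalityI subsetI)
    fix i assume "i \<in> {i \<in> {1..totient N}. gap N i = g}"
    then show "i \<in> Suc ` {i. i < totient N \<and> gap N (Suc i) = g}"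
      by (intro image_eqI[of _ _ "i - 1"]) auto
  qed auto
  then have "gap_count g N = card {i. i < totient N \<and> ?Q (?E i)}"
    unfolding gap_count_def gap[symmetric] by (simp add: card_image)
  also have "\<dots> = card (?E ` {i. i < totient N \<and> ?Q (?E i)})"
    using inj_enumerate[OF inf] by (intro card_image[symmetric]) (auto intro: inj_on_subset)
  also have "?E ` {i. i < totient N \<and> ?Q (?E i)} = {k \<in> totatives N. ?Q k}"
    using enumerate_coprimes_image[of N] assms by auto
  also have "\<dots> = {k \<in> {..<N}. coprime k N \<and> coprime (k + g) N \<and>
      (\<forall>j\<in>{0<..<g}. \<not> coprime (k + j) N)}"
  proof -
    \<comment> \<open>Totatives range over 1 to \<open>N\<close>, residues over 0 to
      \<open>N - 1\<close>; for \<open>N > 1\<close> neither 0 nor \<open>N\<close> is coprime to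
      \<open>N\<close>, so the two ranges give the same set.\<close>
    have "k \<in> totatives N \<longleftrightarrow> k < N \<and> coprime k N" for k
      using assms totatives_less[of k N] by (auto simp: in_totatives_iff intro: Nat.gr0I)
    with assms(2) show ?thesis by (auto simp: coprimes_def intro: Nat.gr0I)
  qed
  finally show ?thesis .
qed

section \<open>Counting tuples by the Chinese remainder theorem\<close>

lemma tuple_count_mult:
  assumes "coprime M N" "M > 0" "N > 0"
  shows "tuple_count (M * N) H = tuple_count M H * tuple_count N H"
proof -
  let ?S = "\<lambda>N. {k \<in> {..<N}. \<forall>h\<in>H. coprime (k + h) N}"
  let ?f = "\<lambda>k. (k mod M, k mod N)"
  \<comment> \<open>Coprimality of \<open>k + h\<close> to \<open>m\<close> depends only on
    \<open>k mod m\<close>, so the condition modulo \<open>M * N\<close> splits into independent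
    conditions on the two components of \<open>?f\<close>.\<close>
  have cop: "coprime (k mod m + h) m \<longleftrightarrow> coprime (k + h) m" for k h m :: nat
    by (metis coprime_mod_left_iff coprime_0_right_iff mod_add_left_eq mod_by_0)
  have "bij_betw ?f (?S (M * N)) (?S M \<times> ?S N)"
    unfolding bij_betw_def
  proof
    show "inj_on ?f (?S (M * N))"
    proof (intro inj_onI)
      fix x y assume xy: "x \<in> ?S (M * N)" "y \<in> ?S (M * N)" "?f x = ?f y"
      then have "[x = y] (mod M * N)"
        using assms by (intro coprime_cong_mult_nat) (auto simp: cong_def)
      with xy show "x = y" by (auto simp: cong_def)
    qed
    show "?f ` ?S (M * N) = ?S M \<times> ?S N"
    proof (intro equalityI subsetI)
      fix z assume "z \<in> ?f ` ?S (M * N)"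
      then show "z \<in> ?S M \<times> ?S N"
        using assms by (auto simp: cop)
    next
      fix z assume "z \<in> ?S M \<times> ?S N"
      then obtain a b where ab: "z = (a, b)" "a \<in> ?S M" "b \<in> ?S N" by blast
      obtain x where x: "x < M * N" "[x = a] (mod M)" "[x = b] (mod N)"
        using binary_chinese_remainder_unique_nat[OF assms(1), of a b] assms by auto
      then have xm: "x mod M = a" "x mod N = b"
        using ab by (auto simp: cong_def)
      have "coprime (x + h) (M * N)" if "h \<in> H" for h
        using ab that cop[of x M h] cop[of x N h] by (auto simp: xm)
      with x xm ab show "z \<in> ?f ` ?S (M * N)" by (auto intro!: image_eqI[of _ _ x])
    qed
  qed
  then show ?thesis
    unfolding tuple_count_def by (simp add: bij_betw_same_card card_cartesian_product)
qed

lemma tuple_count_prod_primes: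
  assumes "finite P" "\<And>q. q \<in> P \<Longrightarrow> prime q"
  shows "tuple_count (\<Prod>P) H = (\<Prod>q\<in>P. tuple_count q H)"
  using assms
proof (induction P rule: finite_induct)
  case empty
  show ?case by (simp add: tuple_count_def)
next
  case (insert q P)
  have "coprime q (\<Prod>P)"
    using insert by (intro prod_coprime_right) (auto intro!: primes_coprime)
  moreover have "\<Prod>P > 0"
    using insert by (auto intro!: prod_pos simp: prime_gt_0_nat)
  ultimately show ?case
    using insert by (simp add: tuple_count_mult prime_gt_0_nat)
qed

text \<open>Each \<open>h\<close> excludes exactly one residue \<open>k\<close>, namely that of -h,
  and two elements of \<open>H\<close> exclude the same one iff they agree modulo
  \<open>q\<close>.\<close>

lemma tuple_count_prime:
  assumes "prime q" "finite H"
  shows "tuple_count q H = q - card ((\<lambda>h. h mod q) ` H)"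
proof -
  have q: "q > 0" using assms by (simp add: prime_gt_0_nat)
  \<comment> \<open>\<open>r h\<close> represents -h in \<open>{..<q}\<close>; the outer
    \<open>mod q\<close> sends the value \<open>q\<close>, which arises when \<open>q\<close>
    divides \<open>h\<close>, back to 0.\<close>
  define r where "r = (\<lambda>h. (q - h mod q) mod q)"
  have dvd: "q dvd k + h \<longleftrightarrow> k = r h" if "k < q" for k h
  proof -
    have "h mod q < q" using q by simp
    have "q dvd k + h \<longleftrightarrow> q dvd k + h mod q"
      by (simp add: dvd_eq_mod_eq_0 mod_add_right_eq)
    also have "\<dots> \<longleftrightarrow> k = r h"
    proof (cases "h mod q = 0")
      case True
      then show ?thesis using that q by (auto simp: r_def dest: nat_dvd_not_less)
    next
      case False
      then have rh: "r h = q - h mod q" using q by (simp add: r_def)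
      show ?thesis
      proof
        assume "q dvd k + h mod q"
        \<comment> \<open>The sum lies strictly between 0 and \<open>2 * q\<close>, and the only
          multiple of \<open>q\<close> there is \<open>q\<close> itself.\<close>
        then obtain c where c: "k + h mod q = q * c" by blast
        with False \<open>h mod q < q\<close> that have "0 < q * c" "q * c < q * 2" by linarith+
        then have "c = 1" by (auto simp: less_2_cases_iff)
        with c show "k = r h" by (simp add: rh)
      next
        assume "k = r h"
        then show "q dvd k + h mod q" using \<open>h mod q < q\<close> by (simp add: rh)
      qed
    qed
    finally show ?thesis .
  qed
  have cop: "coprime a q \<longleftrightarrow> \<not> q dvd a" for a
    using assms by (metis coprime_commute prime_imp_coprime coprime_absorb_left not_prime_unit)
  have "{k \<in> {..<q}. \<forall>h\<in>H. coprime (k + h) q} = {..<q} - r ` H"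
    using dvd by (auto simp: cop)
  moreover have "r ` H \<subseteq> {..<q}" using q by (auto simp: r_def)
  ultimately have "tuple_count q H = q - card (r ` H)"
    unfolding tuple_count_def using assms by (simp add: card_Diff_subset)
  \<comment> \<open>\<open>r\<close> factors through the residue class, and negation is injective on
    residues, so the excluded values are as many as the classes of \<open>H\<close>.\<close>
  also have "r ` H = (\<lambda>x. (q - x) mod q) ` (\<lambda>h. h mod q) ` H"
    by (simp add: r_def image_image)
  also have "card \<dots> = card ((\<lambda>h. h mod q) ` H)"
  proof (intro card_image inj_onI)
    fix x y assume xy: "x \<in> (\<lambda>h. h mod q) ` H" "y \<in> (\<lambda>h. h mod q) ` H"
      "(q - x) mod q = (q - y) mod q"
    then have "x < q" "y < q" using q by auto
    with xy(3) show "x = y"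
      by (cases "x = 0"; cases "y = 0") auto
  qed
  finally show ?thesis .
qed

section \<open>Euler's product over primes and the harmonic series\<close>

text \<open>Expanding the product of geometric series yields 1/k once for every k with all prime
  factors in \<open>P\<close>. The induction splits off one prime, k = q^e * m with m composed of
  the remaining primes; taking finite sets \<open>F\<close> keeps all sums finite.\<close>

lemma sum_inverse_le_euler_prod:
  fixes F P :: "nat set"
  assumes "finite P" "\<And>q. q \<in> P \<Longrightarrow> prime q" "finite F"
    and "\<And>k. k \<in> F \<Longrightarrow> k > 0 \<and> prime_factors k \<subseteq> P"
  shows "(\<Sum>k\<in>F. 1 / real k) \<le> (\<Prod>q\<in>P. 1 / (1 - 1 / real q))"
  using assms
proof (induction P arbitrary: F rule: finite_induct)
  case empty
  have "F \<subseteq> {1}"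
  proof
    fix k assume "k \<in> F"
    then have "k > 0" "prime_factors k = {}" using empty by auto
    then show "k \<in> {1}" by (simp add: prime_factorization_empty_iff)
  qed
  then have "(\<Sum>k\<in>F. 1 / real k) \<le> (\<Sum>k\<in>{1}. 1 / real k)"
    by (intro sum_mono2) auto
  then show ?case by simp
next
  case (insert q P)
  have q: "prime q" using insert by simp
  then have q1: "q > 1" by (rule prime_gt_1_nat)
  define part where "part = (\<lambda>k. k div q ^ multiplicity q k)"
  define c where "c = 1 / real q"
  have c: "0 < c" "c < 1" using q1 by (auto simp: c_def)
  have split: "k = q ^ multiplicity q k * part k" for k
    by (simp add: part_def multiplicity_dvd)
  have part: "part k > 0 \<and> prime_factors (part k) \<subseteq> P" if "k \<in> F" for k
  proof -
    have k: "k > 0" "prime_factors k \<subseteq> insert q P" using insert that by auto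
    then have pos: "part k > 0" using split[of k] by (metis gr0I mult_0_right less_irrefl)
    have "part k dvd k" using split[of k] by (metis dvd_triv_right)
    then have "prime_factors (part k) \<subseteq> prime_factors k"
      using k by (intro dvd_prime_factors) auto
    moreover have "\<not> q dvd part k"
      unfolding part_def using k q1 by (intro multiplicity_decompose) auto
    ultimately show ?thesis using k pos by (auto simp: in_prime_factors_iff)
  qed
  let ?m = "\<lambda>k. (multiplicity q k, part k)"
  \<comment> \<open>\<open>K\<close> exceeds every exponent of \<open>q\<close> in \<open>F\<close>,
    so the pairs (exponent, cofactor) fit into a finite rectangle. Enlarging to the rectangle adds
    only nonnegative terms, and there the sum factors.\<close>
  define K where "K = Suc (Max (multiplicity q ` F))"
  have sub: "?m ` F \<subseteq> {..<K} \<times> part ` F"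
    using \<open>finite F\<close> by (auto simp: K_def less_Suc_eq_le)
  have inj: "inj_on ?m F"
  proof (intro inj_onI)
    fix x y assume "?m x = ?m y"
    then show "x = y" using split[of x] split[of y] by simp
  qed
  have "(\<Sum>k\<in>F. 1 / real k) = (\<Sum>k\<in>F. c ^ multiplicity q k * (1 / real (part k)))"
  proof (intro sum.cong refl)
    fix k
    have "real k = real q ^ multiplicity q k * real (part k)"
      using split[of k] by (metis of_nat_mult of_nat_power)
    then show "1 / real k = c ^ multiplicity q k * (1 / real (part k))"
      by (simp add: c_def power_one_over divide_simps)
  qed
  also have "\<dots> = (\<Sum>(e, m)\<in>?m ` F. c ^ e * (1 / real m))"
    using inj by (simp add: sum.reindex)
  also have "\<dots> \<le> (\<Sum>(e, m)\<in>{..<K} \<times> part ` F. c ^ e * (1 / real m))"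
    using sub insert c by (intro sum_mono2) auto
  also have "\<dots> = (\<Sum>e<K. c ^ e) * (\<Sum>m\<in>part ` F. 1 / real m)"
    by (simp add: sum_product sum.cartesian_product)
  also have "\<dots> \<le> 1 / (1 - c) * (\<Prod>q\<in>P. 1 / (1 - 1 / real q))"
  proof (intro mult_mono)
    show "(\<Sum>e<K. c ^ e) \<le> 1 / (1 - c)"
      using c by (simp add: sum_gp_strict divide_right_mono)
    show "(\<Sum>m\<in>part ` F. 1 / real m) \<le> (\<Prod>q\<in>P. 1 / (1 - 1 / real q))"
    proof (rule insert.IH)
      show "prime x" if "x \<in> P" for x using insert.prems(1) that by simp
      show "finite (part ` F)" using \<open>finite F\<close> by simp
      show "k > 0 \<and> prime_factors k \<subseteq> P" if "k \<in> part ` F" for k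
        using that part by blast
    qed
  qed (use c in \<open>auto intro: sum_nonneg\<close>)
  also have "\<dots> = (\<Prod>q\<in>insert q P. 1 / (1 - 1 / real q))"
    using insert.hyps by (simp add: c_def)
  finally show ?case .
qed

text \<open>Every k from 1 to p has only prime factors up to p, so the harmonic number of p is at
  most the inverse of the product. Its divergence pushes the product to 0.\<close>

lemma prod_one_minus_inverse_primes_tendsto_0:
  "(\<lambda>p::nat. \<Prod>q | prime q \<and> q \<le> p. 1 - 1 / real q) \<longlonglongrightarrow> 0"
proof (rule tendsto_sandwich[of "\<lambda>_. 0"])
  show "(\<lambda>p. inverse (harm p :: real)) \<longlonglongrightarrow> 0"
    using harm_at_top by (rule tendsto_inverse_0_at_top)
  show "\<forall>\<^sub>F p in sequentially. (\<Prod>q | prime q \<and> q \<le> p. 1 - 1 / real q) \<le> inverse (harm p)"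
    using eventually_gt_at_top[of 0]
  proof eventually_elim
    fix p :: nat assume "p > 0"
    have "harm p = (\<Sum>k\<in>{1..p}. 1 / real k)"
      by (simp add: harm_def inverse_eq_divide)
    also have "\<dots> \<le> (\<Prod>q | prime q \<and> q \<le> p. 1 / (1 - 1 / real q))"
      by (intro sum_inverse_le_euler_prod)
         (auto simp: in_prime_factors_iff intro: order_trans[OF dvd_imp_le])
    also have "\<dots> = inverse (\<Prod>q | prime q \<and> q \<le> p. 1 - 1 / real q)"
      by (simp add: inverse_eq_divide prod_dividef)
    finally have "harm p \<le> inverse (\<Prod>q | prime q \<and> q \<le> p. 1 - 1 / real q)" .
    moreover have "(harm p :: real) > 0" using \<open>p > 0\<close> by (rule harm_pos)
    ultimately show "(\<Prod>q | prime q \<and> q \<le> p. 1 - 1 / real q) \<le> inverse (harm p)"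
      using le_imp_inverse_le by fastforce
  qed
qed (auto intro!: always_eventually prod_nonneg simp: divide_simps prime_gt_0_nat Suc_leI)

lemma prod_primes_tendsto_0:
  fixes r :: "nat \<Rightarrow> real"
  assumes nonneg: "\<And>q. prime q \<Longrightarrow> r q \<ge> 0"
    and le: "\<And>q. prime q \<Longrightarrow> q > m \<Longrightarrow> r q \<le> 1 - 1 / real q"
  shows "(\<lambda>p. \<Prod>q | prime q \<and> q \<le> p. r q) \<longlonglongrightarrow> 0"
proof (rule tendsto_sandwich[of "\<lambda>_. 0"])
  let ?f = "\<lambda>q. 1 - 1 / real q"
  \<comment> \<open>The comparison with \<open>?f\<close> may fail at primes up to \<open>m\<close>;
    \<open>?C\<close> is the constant that exchanges these finitely many factors.\<close>
  let ?C = "(\<Prod>q | prime q \<and> q \<le> m. r q / ?f q)"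
  have f: "?f q > 0" if "prime q" for q
    using prime_gt_1_nat[OF that] by simp
  show "(\<lambda>p. ?C * (\<Prod>q | prime q \<and> q \<le> p. ?f q)) \<longlonglongrightarrow> 0"
    using tendsto_mult_left[OF prod_one_minus_inverse_primes_tendsto_0, of ?C] by simp
  show "\<forall>\<^sub>F p in sequentially. (\<Prod>q | prime q \<and> q \<le> p. r q)
      \<le> ?C * (\<Prod>q | prime q \<and> q \<le> p. ?f q)"
    using eventually_ge_at_top[of m]
  proof eventually_elim
    fix p assume "m \<le> p"
    then have eq: "{q. prime q \<and> q \<le> p} = {q. prime q \<and> q \<le> m} \<union> {q. prime q \<and> m < q \<and> q \<le> p}"
      by auto
    have split: "(\<Prod>q | prime q \<and> q \<le> p. g q) =
        (\<Prod>q | prime q \<and> q \<le> m. g q) * (\<Prod>q | prime q \<and> m < q \<and> q \<le> p. g q)"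
      for g :: "nat \<Rightarrow> real"
      unfolding eq by (rule prod.union_disjoint) auto
    have "(\<Prod>q | prime q \<and> q \<le> m. ?f q) > 0" using f by (intro prod_pos) auto
    then have "?C * (\<Prod>q | prime q \<and> q \<le> m. ?f q) = (\<Prod>q | prime q \<and> q \<le> m. r q)"
      by (simp add: prod_dividef)
    moreover have "(\<Prod>q | prime q \<and> m < q \<and> q \<le> p. r q)
        \<le> (\<Prod>q | prime q \<and> m < q \<and> q \<le> p. ?f q)"
      using nonneg le by (intro prod_mono) auto
    moreover have "(\<Prod>q | prime q \<and> q \<le> m. r q) \<ge> 0"
      using nonneg by (intro prod_nonneg) auto
    ultimately show "(\<Prod>q | prime q \<and> q \<le> p. r q) \<le> ?C * (\<Prod>q | prime q \<and> q \<le> p. ?f q)"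
      unfolding split[of r] split[of ?f] mult.assoc[symmetric] by (simp add: mult_left_mono)
  qed
qed (use nonneg in \<open>auto intro!: always_eventually prod_nonneg\<close>)


section \<open>Pairs and triples modulo primorials\<close>

lemma tuple_count_primorial:
  "tuple_count (primorial p) H = (\<Prod>q | prime q \<and> q \<le> p. tuple_count q H)"
  unfolding primorial_def by (rule tuple_count_prod_primes) auto

lemma tuple_count_prime_pair:
  assumes "prime q"
  shows "tuple_count q {0, g} = (if q dvd g then q - 1 else q - 2)"
  using assms by (auto simp: tuple_count_prime dvd_eq_mod_eq_0)

lemma tuple_count_prime_triple:
  assumes "prime q" "0 < i" "i < j" "j < q"
  shows "tuple_count q {0, i, j} = q - 3"
  using assms by (simp add: tuple_count_prime)

text \<open>For odd \<open>q\<close> the factor 2 is invertible, so only divisibility of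
  \<open>n\<close> matters. At \<open>q = 2\<close> both sets occupy a single class and both counts
  are 1.\<close>

lemma tuple_count_prime_ratio:
  assumes "prime q"
  shows "real (tuple_count q {0, 2 * n}) / real (tuple_count q {0, 2}) =
    (if q > 2 \<and> q dvd n then (real q - 1) / (real q - 2) else 1)"
proof (cases "q = 2")
  case False
  with prime_ge_2_nat[OF assms] have q: "q > 2" by simp
  then have "\<not> q dvd 2" by (simp add: nat_dvd_not_less)
  then have "q dvd 2 * n \<longleftrightarrow> q dvd n"
    using assms by (simp add: prime_dvd_mult_iff)
  with q \<open>\<not> q dvd 2\<close> show ?thesis
    using assms by (simp add: tuple_count_prime_pair of_nat_diff)
qed (simp add: tuple_count_prime_pair)

text \<open>Only primes dividing \<open>n\<close> contribute a factor other than 1, and all of them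
  are at most \<open>p\<close> once \<open>n \<le> p\<close>. From then on the ratio is constant,
  not merely convergent.\<close>

lemma tuple_count_primorial_ratio:
  assumes "n > 0" "n \<le> p"
  shows "real (tuple_count (primorial p) {0, 2 * n}) / real (tuple_count (primorial p) {0, 2}) =
    (\<Prod>q\<in>{q. prime q \<and> q > 2 \<and> q dvd n}. (real q - 1) / (real q - 2))"
proof -
  have "real (tuple_count (primorial p) {0, 2 * n}) / real (tuple_count (primorial p) {0, 2}) =
      (\<Prod>q | prime q \<and> q \<le> p. if q > 2 \<and> q dvd n then (real q - 1) / (real q - 2) else 1)"
    unfolding tuple_count_primorial of_nat_prod prod_dividef[symmetric]
    by (intro prod.cong) (auto simp: tuple_count_prime_ratio simp del: of_nat_mult)
  also have "\<dots> = (\<Prod>q\<in>{q. prime q \<and> q > 2 \<and> q dvd n}. (real q - 1) / (real q - 2))"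
  proof (rule prod.mono_neutral_cong_right)
    show "{q. prime q \<and> q > 2 \<and> q dvd n} \<subseteq> {q. prime q \<and> q \<le> p}"
      using assms by (auto intro: order_trans[OF dvd_imp_le])
  qed auto
  finally show ?thesis .
qed

lemma tuple_count_triple_ratio_tendsto_0:
  assumes "0 < i" "i < j"
  shows "(\<lambda>p. real (tuple_count (primorial p) {0, i, j}) / real (tuple_count (primorial p) {0, 2}))
    \<longlonglongrightarrow> 0"
proof -
  define r where "r = (\<lambda>q. real (tuple_count q {0, i, j}) / real (tuple_count q {0, 2}))"
  have "(\<lambda>p. \<Prod>q | prime q \<and> q \<le> p. r q) \<longlonglongrightarrow> 0"
  proof (rule prod_primes_tendsto_0)
    fix q assume q: "prime q" "q > j"
    \<comment> \<open>This bound makes the natural subtractions exact and \<open>q - 2\<close>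
      positive. The estimate below then amounts to q(q - 3) \<le> (q - 1)(q - 2).\<close>
    then have q3: "q \<ge> 3" using assms by simp
    then have "r q = (real q - 3) / (real q - 2)"
      using q assms
      by (simp add: r_def tuple_count_prime_triple tuple_count_prime_pair nat_dvd_not_less of_nat_diff)
    also have "\<dots> \<le> 1 - 1 / real q"
      using q3 by (simp add: field_simps)
    finally show "r q \<le> 1 - 1 / real q" .
  qed (simp add: r_def)
  then show ?thesis
    by (simp add: r_def tuple_count_primorial prod_dividef)
qed

lemma primorial_even:
  assumes "p \<ge> 2"
  shows "even (primorial p)"
  unfolding primorial_def using assms by (intro dvd_prodI) auto

lemma primorial_gt_1:
  assumes "p \<ge> 2"
  shows "primorial p > 1"
proof -
  have "primorial p > 0"
    unfolding primorial_def by (intro prod_pos) (auto simp: prime_gt_0_nat)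
  with primorial_even[OF assms] show ?thesis by (auto elim!: evenE)
qed

section \<open>From tuples to gaps\<close>

text \<open>If \<open>k\<close> is coprime to an even \<open>N\<close>, then \<open>k + 1\<close> is
  even, so nothing can interrupt a pair at distance 2.\<close>

lemma gap_count_2_eq_tuple_count:
  assumes "even N" "N > 1"
  shows "gap_count 2 N = tuple_count N {0, 2}"
proof -
  have "\<not> coprime (k + 1) N" if "coprime k N" for k
    using assms that by (metis coprime_common_divisor even_plus_one_iff odd_one)
  moreover have "{0<..<2} = {1::nat}" by auto
  ultimately show ?thesis
    unfolding gap_count_eq_card[OF assms(2) zero_less_numeral] tuple_count_def
    by (intro arg_cong[where f = card]) auto
qed

lemma gap_count_le_tuple_count:
  assumes "N > 1" "g > 0"
  shows "gap_count g N \<le> tuple_count N {0, g}"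
  unfolding gap_count_eq_card[OF assms] tuple_count_def by (intro card_mono) auto

text \<open>A union bound: a pair that is not a gap has some \<open>k + j\<close> coprime to
  \<open>N\<close> strictly between its ends, so it is counted in one of the triples.\<close>

lemma tuple_count_le_gap_count_add:
  assumes "N > 1" "g > 0"
  shows "tuple_count N {0, g} \<le> gap_count g N + (\<Sum>j\<in>{0<..<g}. tuple_count N {0, j, g})"
proof -
  let ?A = "{k \<in> {..<N}. coprime k N \<and> coprime (k + g) N \<and> (\<forall>j\<in>{0<..<g}. \<not> coprime (k + j) N)}"
  let ?B = "\<lambda>j. {k \<in> {..<N}. \<forall>h\<in>{0, j, g}. coprime (k + h) N}"
  have "tuple_count N {0, g} \<le> card (?A \<union> (\<Union>j\<in>{0<..<g}. ?B j))"
    unfolding tuple_count_def by (intro card_mono) auto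
  also have "\<dots> \<le> card ?A + card (\<Union>j\<in>{0<..<g}. ?B j)"
    by (rule card_Un_le)
  also have "card (\<Union>j\<in>{0<..<g}. ?B j) \<le> (\<Sum>j\<in>{0<..<g}. card (?B j))"
    by (intro card_UN_le) auto
  finally show ?thesis
    unfolding gap_count_eq_card[OF assms] tuple_count_def by simp
qed

lemma gap_count_ratio_tendsto:
  assumes "n > 0"
  shows "(\<lambda>p. real (gap_count (2 * n) (primorial p)) / real (gap_count 2 (primorial p)))
    \<longlonglongrightarrow> (\<Prod>q\<in>{q. prime q \<and> q > 2 \<and> q dvd n}. (real q - 1) / (real q - 2))"
    (is "?R \<longlonglongrightarrow> ?L")
proof (rule tendsto_sandwich)
  let ?T = "\<lambda>H p. real (tuple_count (primorial p) H)"
  let ?lower = "\<lambda>p. ?L - (\<Sum>j\<in>{0<..<2 * n}. ?T {0, j, 2 * n} p / ?T {0, 2} p)"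
  have "?lower \<longlonglongrightarrow> ?L - (\<Sum>j\<in>{0<..<2 * n}. 0)"
    by (intro tendsto_intros tuple_count_triple_ratio_tendsto_0) auto
  then show "?lower \<longlonglongrightarrow> ?L" by simp
  \<comment> \<open>\<open>p \<ge> 2\<close> makes the primorial even, so the denominator is an
    exact tuple count; \<open>p \<ge> n\<close> makes the ratio of pair counts equal to
    \<open>?L\<close>.\<close>
  have bounds: "?lower p \<le> ?R p \<and> ?R p \<le> ?L" if "p \<ge> max 2 n" for p
  proof -
    let ?N = "primorial p"
    have N: "even ?N" "?N > 1"
      using that primorial_even primorial_gt_1 by auto
    have twin: "real (gap_count 2 ?N) = ?T {0, 2} p"
      using gap_count_2_eq_tuple_count[OF N] by simp
    have L: "?L = ?T {0, 2 * n} p / ?T {0, 2} p"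
      using tuple_count_primorial_ratio[OF assms, of p] that by simp
    have "real (gap_count (2 * n) ?N) \<le> ?T {0, 2 * n} p"
      using gap_count_le_tuple_count[OF N(2), of "2 * n"] assms by simp
    moreover have "?T {0, 2 * n} p - (\<Sum>j\<in>{0<..<2 * n}. ?T {0, j, 2 * n} p)
        \<le> real (gap_count (2 * n) ?N)"
      using tuple_count_le_gap_count_add[OF N(2), of "2 * n"] assms
      unfolding of_nat_sum[symmetric] by linarith
    ultimately show ?thesis
      unfolding L twin sum_divide_distrib[symmetric] diff_divide_distrib[symmetric]
      by (simp add: divide_right_mono)
  qed
  show "\<forall>\<^sub>F p in sequentially. ?lower p \<le> ?R p" "\<forall>\<^sub>F p in sequentially. ?R p \<le> ?L"
    using eventually_ge_at_top[of "max 2 n"] by (eventually_elim, use bounds in blast)+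
qed simp

theorem theorem6p5:
  fixes n :: nat
  assumes "n > 0"
  shows "infinite {p. prime p \<and> 2 * n \<in> set (cycle_of_gaps (primorial p))} \<and>
    ((\<lambda>p. real (gap_count (2 * n) (primorial p)) / real (gap_count 2 (primorial p)))
       \<longlongrightarrow> (\<Prod>q\<in>{q. prime q \<and> q > 2 \<and> q dvd n}. (real q - 1) / (real q - 2)))
      (inf at_top (principal {p. prime p}))"
proof
  let ?L = "\<Prod>q\<in>{q. prime q \<and> q > 2 \<and> q dvd n}. (real q - 1) / (real q - 2)"
  note lim = gap_count_ratio_tendsto[OF assms]
  show "((\<lambda>p. real (gap_count (2 * n) (primorial p)) / real (gap_count 2 (primorial p)))
      \<longlongrightarrow> ?L) (inf at_top (principal {p. prime p}))"
    \<comment> \<open>The limit was proved along all natural numbers \<open>p\<close>; restricting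
      to primes only refines the filter.\<close>
    by (rule tendsto_mono[OF inf_le1 lim])
  \<comment> \<open>Each factor has \<open>q > 2\<close> and is positive. A positive limit makes the
    ratio eventually positive, which rules out a zero numerator, so the gap occurs for all large
    \<open>p\<close>.\<close>
  have "?L > 0" by (intro prod_pos) auto
  then have "\<forall>\<^sub>F p in sequentially.
      real (gap_count (2 * n) (primorial p)) / real (gap_count 2 (primorial p)) > 0"
    by (rule order_tendstoD(1)[OF lim])
  then obtain m where m: "\<And>p. p \<ge> m \<Longrightarrow> gap_count (2 * n) (primorial p) > 0"
    unfolding eventually_sequentially by (metis gr0I div_0 of_nat_0 less_irrefl)
  have "2 * n \<in> set (cycle_of_gaps (primorial p))" if "p \<ge> m" for p
  proof -
    have "{i \<in> {1..totient (primorial p)}. gap (primorial p) i = 2 * n} \<noteq> {}"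
      using m[OF that] unfolding gap_count_def by (metis card.empty less_irrefl)
    then show ?thesis
      by (fastforce simp: cycle_of_gaps_def image_iff)
  qed
  then have "{p. prime p} - {..<m} \<subseteq> {p. prime p \<and> 2 * n \<in> set (cycle_of_gaps (primorial p))}"
    by auto
  moreover have "infinite ({p::nat. prime p} - {..<m})"
    using primes_infinite by simp
  ultimately show "infinite {p. prime p \<and> 2 * n \<in> set (cycle_of_gaps (primorial p))}"
    using finite_subset by blast
qed

end
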